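(* Let $n\ge 1$ and let $S^n\subset\mathbb{R}^{n+1}$ be the Euclidean unit sphere. Then the set $$\mathrm{BA}(S^n):=\left\{\alpha\in S^n:\ \exists\, c=c(\alpha)>0\text{ such that } \left\|\alpha-\frac{\mathbf{p}}{q}\right\|>\frac{c}{q}\ \text{ for all }\ (\mathbf{p},q)\in\mathbb{Z}^{n+1}\times\mathbb{N}\text{ with }\frac{\mathbf{p}}{q}\in S^n\right\}$$ is thick in $S^n$.
   Context: $\|\cdot\|$ is the supremum norm on $\mathbb{R}^{n+1}$. A subset of a metric space $X$ is called thick if its intersection with any nonempty open subset of $X$ has full Hausdorff dimension (that is, Hausdorff dimension equal to that of $X$; here $n$). *)

theory Defs
  imports "HOL-Analysis.Analysis"
begin

text \<open>Hausdorff measure and dimension of subsets of a metric space. The gauge sets the convention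
  that a nonempty set has weight 1 for \<open>s = 0\<close> (\<open>0 powr 0 = 0\<close> in HOL), so that
  the 0-dimensional measure is counting measure. The empty set has dimension 0.\<close>

definition hausdorff_gauge :: "real \<Rightarrow> 'a::metric_space set \<Rightarrow> ennreal" where
  "hausdorff_gauge s U =
     (if U = {} then 0 else if s = 0 then 1 else ennreal (diameter U powr s))"

text \<open>The explicit boundedness condition is needed because \<^const>\<open>diameter\<close> is unspecified on
  unbounded sets. Finite covers are included, since some of the \<open>U i\<close> may be empty.\<close>

definition hausdorff_content :: "real \<Rightarrow> real \<Rightarrow> 'a::metric_space set \<Rightarrow> ennreal" where
  "hausdorff_content s \<delta> A =
     (INF U \<in> {U :: nat \<Rightarrow> 'a set. A \<subseteq> (\<Union>i. U i) \<and> (\<forall>i. bounded (U i) \<and> diameter (U i) \<le> \<delta>)}.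
        \<Sum>i. hausdorff_gauge s (U i))"

definition hausdorff_measure :: "real \<Rightarrow> 'a::metric_space set \<Rightarrow> ennreal" where
  "hausdorff_measure s A = (SUP \<delta> \<in> {0<..}. hausdorff_content s \<delta> A)"

definition hausdorff_dim :: "'a::metric_space set \<Rightarrow> ennreal" where
  "hausdorff_dim A = Inf {ennreal s | s. 0 \<le> s \<and> hausdorff_measure s A = 0}"

definition thick_in :: "'a::metric_space set \<Rightarrow> 'a set \<Rightarrow> bool" where
  "thick_in X A \<longleftrightarrow> A \<subseteq> X \<and>
     (\<forall>V. openin (top_of_set X) V \<and> V \<noteq> {} \<longrightarrow> hausdorff_dim (A \<inter> V) = hausdorff_dim X)"

definition rational_point :: "int ^ 'm \<Rightarrow> nat \<Rightarrow> real ^ 'm" where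
  "rational_point p q = (\<chi> i. real_of_int (p $ i) / real q)"

text \<open>Intrinsic approximation on \<open>X\<close>: only rational points lying on \<open>X\<close> are considered. Denominators
  are positive, and distances are measured in the supremum norm \<^const>\<open>infnorm\<close>.\<close>

definition BA :: "(real ^ 'm) set \<Rightarrow> (real ^ 'm) set" where
  "BA X = {\<alpha> \<in> X. \<exists>c>0. \<forall>(p :: int ^ 'm) (q :: nat).
     q > 0 \<and> rational_point p q \<in> X \<longrightarrow> infnorm (\<alpha> - rational_point p q) > c / real q}"

end

theory Submission
  imports Defs "HOL-Real_Asymp.Real_Asymp"
begin

text \<open>For distinct rational points \<open>p / q\<close>, \<open>p' / q'\<close> of the sphere the squared distance
  \<open>2 (q q' - p \<bullet> p') / (q q')\<close> is at least \<open>2 / (q q')\<close>. Hence a ball of radius \<open>r\<close> comes close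
  to at most one rational point with denominator of order \<open>1 / r\<close>. Given a cover of a piece of
  \<open>BA\<close> by sets \<open>U i\<close> with \<open>\<Sum> (diameter (U i)) powr s\<close> small, where \<open>s < n\<close>, one chooses nested
  balls of radii \<open>r\<^sub>k = r\<^sub>0 / N ^ k\<close>. At each step about \<open>N ^ n\<close> separated subballs are available;
  one of them is discarded because of the rational point, and among the others one is hit by \<open>U i\<close>
  of total weight less than \<open>(r\<^sub>k / N) powr s\<close>, because \<open>N powr s\<close> is much smaller than \<open>N ^ n\<close>.
  The common point of the balls is badly approximable and lies in no \<open>U i\<close>, so the dimension is at
  least \<open>n\<close>.\<close>

section \<open>Monotonicity and finite covers for Hausdorff content\<close>

lemma hausdorff_content_mono:
  "A \<subseteq> B \<Longrightarrow> hausdorff_content s \<delta> A \<le> hausdorff_content s \<delta> B"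
  unfolding hausdorff_content_def by (intro INF_superset_mono) auto

lemma hausdorff_measure_mono:
  "A \<subseteq> B \<Longrightarrow> hausdorff_measure s A \<le> hausdorff_measure s B"
  unfolding hausdorff_measure_def by (intro SUP_mono') (rule hausdorff_content_mono)

lemma hausdorff_dim_mono:
  assumes "A \<subseteq> B"
  shows "hausdorff_dim A \<le> hausdorff_dim B"
proof -
  have "hausdorff_measure s A = 0" if "hausdorff_measure s B = 0" for s
    using hausdorff_measure_mono[OF assms, of s] that by simp
  then show ?thesis unfolding hausdorff_dim_def by (intro Inf_superset_mono) auto
qed

lemma hausdorff_content_eq_0_if_measure_eq_0:
  assumes "hausdorff_measure s A = 0" "\<delta> > 0"
  shows "hausdorff_content s \<delta> A = 0"
proof -
  have "hausdorff_content s \<delta> A \<le> hausdorff_measure s A"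
    unfolding hausdorff_measure_def using assms(2) by (intro SUP_upper) auto
  then show ?thesis using assms(1) by simp
qed

text \<open>Meant for grids: a finite cover over any index type needs only one common bound for the
  distances within its cells. For \<open>s > 0\<close> each cell then has gauge at most
  \<open>d powr s\<close>.\<close>

lemma hausdorff_content_finite_cover:
  fixes A :: "'a::metric_space set"
  assumes "finite I" "A \<subseteq> (\<Union>i\<in>I. C i)" "s > 0" "0 \<le> d" "d \<le> \<delta>"
    and diam: "\<And>i x y. i \<in> I \<Longrightarrow> x \<in> C i \<Longrightarrow> y \<in> C i \<Longrightarrow> dist x y \<le> d"
  shows "hausdorff_content s \<delta> A \<le> ennreal (card I * d powr s)"
proof -
  obtain f :: "nat \<Rightarrow> 'b" where f: "bij_betw f {..<card I} I"
    using ex_bij_betw_nat_finite[OF assms(1)] by (auto simp: atLeast0LessThan)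
  \<comment> \<open>Empty sets extend the family to a sequence. They have gauge 0 and, by
    convention, diameter 0, which \<open>0 \<le> d\<close> makes admissible.\<close>
  define U where "U i = (if i < card I then C (f i) else {})" for i
  have fI: "i < card I \<Longrightarrow> f i \<in> I" for i using f by (auto simp: bij_betw_def)
  have bU: "bounded (U i)" for i
  proof (cases "U i = {}")
    case False
    then obtain x where "x \<in> U i" by blast
    then show ?thesis using diam[OF fI[of i], of x] unfolding bounded_def
      by (metis U_def empty_iff)
  qed auto
  have dU: "diameter (U i) \<le> d" for i
    using diam[OF fI[of i]] assms(4) unfolding U_def diameter_def
    by (auto intro!: cSUP_least)
  have "(\<Union>i\<in>I. C i) = (\<Union>i. U i)"
    using f unfolding U_def bij_betw_def by (auto split: if_splits) (metis imageE lessThan_iff)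
  then have "hausdorff_content s \<delta> A \<le> (\<Sum>i. hausdorff_gauge s (U i))"
    unfolding hausdorff_content_def using assms(2) bU order_trans[OF dU assms(5)]
    by (intro INF_lower) auto
  also have "\<dots> = (\<Sum>i<card I. hausdorff_gauge s (U i))"
    by (intro suminf_finite) (auto simp: U_def hausdorff_gauge_def)
  also have "\<dots> \<le> (\<Sum>i<card I. ennreal (d powr s))"
  proof (intro sum_mono)
    fix i
    have "diameter (U i) powr s \<le> d powr s"
      using dU[of i] diameter_ge_0[OF bU[of i]] assms(3) by (intro powr_mono2) auto
    then show "hausdorff_gauge s (U i) \<le> ennreal (d powr s)"
      using assms(3) by (auto simp: hausdorff_gauge_def intro!: ennreal_leI)
  qed
  also have "\<dots> = ennreal (card I * d powr s)"
    by (simp add: ennreal_mult ennreal_of_nat_eq_real_of_nat)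
  finally show ?thesis .
qed

section \<open>Upper bound for the dimension of the sphere\<close>

text \<open>On the part of the sphere where the \<open>i\<close>-th coordinate dominates and has a fixed sign,
  that coordinate is a Lipschitz function of the others.\<close>

lemma sphere_dominant_coordinate_Lipschitz:
  fixes x y :: "real ^ 'm" and e :: real
  assumes "norm x = 1" "norm y = 1"
    and e: "0 \<le> e"
    and dom: "\<And>j. \<bar>x $ j\<bar> \<le> \<bar>x $ i\<bar>" "\<And>j. \<bar>y $ j\<bar> \<le> \<bar>y $ i\<bar>"
    and sgn: "(0 \<le> x $ i) = (0 \<le> y $ i)"
    and near: "\<And>j. j \<noteq> i \<Longrightarrow> \<bar>x $ j - y $ j\<bar> \<le> e"
  shows "dist x y \<le> 2 * CARD('m) * e"
proof -
  let ?D = "\<Sum>j\<in>UNIV - {i}. \<bar>x $ j - y $ j\<bar>"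
  have sq: "(\<Sum>j\<in>UNIV. (x $ j)\<^sup>2) = 1" "(\<Sum>j\<in>UNIV. (y $ j)\<^sup>2) = 1"
    using assms(1,2) by (simp_all add: norm_vec_def L2_set_def)
  have xi: "(x $ i)\<^sup>2 = 1 - (\<Sum>j\<in>UNIV-{i}. (x $ j)\<^sup>2)" "(y $ i)\<^sup>2 = 1 - (\<Sum>j\<in>UNIV-{i}. (y $ j)\<^sup>2)"
    using sq sum.remove[of UNIV i "\<lambda>j. (x $ j)\<^sup>2"] sum.remove[of UNIV i "\<lambda>j. (y $ j)\<^sup>2"] by auto
  \<comment> \<open>\<open>T\<close> is the factor common to all differences of squares: equal signs
    give \<open>T = \<bar>x $ i + y $ i\<bar>\<close>, and dominance bounds every
    \<open>\<bar>x $ j + y $ j\<bar>\<close> by \<open>T\<close>. It cancels at the end because a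
    unit vector has a nonzero dominant coordinate.\<close>
  define T where "T = \<bar>x $ i\<bar> + \<bar>y $ i\<bar>"
  have "T \<noteq> 0"
  proof
    assume "T = 0"
    then have "x $ j = 0" for j using dom(1)[of j] unfolding T_def by auto
    then show False using sq(1) by simp
  qed
  then have T: "T > 0" unfolding T_def by auto
  have "\<bar>x $ i - y $ i\<bar> * T = \<bar>(x $ i)\<^sup>2 - (y $ i)\<^sup>2\<bar>"
  proof -
    have "T = \<bar>x $ i + y $ i\<bar>" using sgn unfolding T_def by auto
    then show ?thesis by (simp add: abs_mult[symmetric] power2_eq_square algebra_simps)
  qed
  also have "\<dots> = \<bar>\<Sum>j\<in>UNIV-{i}. (y $ j)\<^sup>2 - (x $ j)\<^sup>2\<bar>" unfolding xi by (simp add: sum_subtractf)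
  also have "\<dots> \<le> (\<Sum>j\<in>UNIV-{i}. \<bar>(y $ j)\<^sup>2 - (x $ j)\<^sup>2\<bar>)" by (rule sum_abs)
  also have "\<dots> \<le> (\<Sum>j\<in>UNIV-{i}. \<bar>x $ j - y $ j\<bar> * T)"
  proof (intro sum_mono)
    fix j
    have "\<bar>(y $ j)\<^sup>2 - (x $ j)\<^sup>2\<bar> = \<bar>x $ j - y $ j\<bar> * \<bar>x $ j + y $ j\<bar>"
      by (simp add: abs_mult[symmetric] power2_eq_square algebra_simps)
    also have "\<dots> \<le> \<bar>x $ j - y $ j\<bar> * T"
      using dom(1)[of j] dom(2)[of j] unfolding T_def by (intro mult_left_mono) auto
    finally show "\<bar>(y $ j)\<^sup>2 - (x $ j)\<^sup>2\<bar> \<le> \<bar>x $ j - y $ j\<bar> * T" .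
  qed
  also have "\<dots> = ?D * T" by (simp add: sum_distrib_right)
  finally have i: "\<bar>x $ i - y $ i\<bar> \<le> ?D" using T by simp
  have "dist x y \<le> (\<Sum>j\<in>UNIV. \<bar>(x - y) $ j\<bar>)" unfolding dist_norm by (rule norm_le_l1_cart)
  also have "\<dots> = \<bar>x $ i - y $ i\<bar> + ?D" by (subst sum.remove[of _ i]) auto
  also have "\<dots> \<le> 2 * ?D" using i by simp
  also have "?D \<le> (\<Sum>j\<in>UNIV-{i}. e)" using near by (intro sum_mono) auto
  also have "(\<Sum>j\<in>UNIV-{i}. e) = (CARD('m) - 1) * e" by (simp add: card_Diff_singleton)
  also have "2 * ((CARD('m) - 1) * e) \<le> 2 * CARD('m) * e" using e by (simp add: mult_right_mono)
  finally show ?thesis by simp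
qed

text \<open>The sphere is cut according to the index of a dominant coordinate, its sign, and the
  grid cell of side \<open>1 / k\<close> containing the other coordinates. Floors of
  \<open>k * x $ j\<close> range over \<open>2 * k + 1\<close> integers, and the Lipschitz bound
  controls the diameter of each piece.\<close>

lemma sphere_content_le:
  fixes k :: nat
  assumes "s > 0" "k > 0" "2 * CARD('m) / k \<le> \<delta>"
  shows "hausdorff_content s \<delta> (sphere 0 1 :: (real ^ 'm) set)
    \<le> ennreal (2 * CARD('m) * (2 * k + 1) ^ (CARD('m) - 1) * (2 * CARD('m) / k) powr s)"
proof -
  define G :: "'m \<Rightarrow> ('m \<Rightarrow> int) set"
    where "G i = (UNIV - {i}) \<rightarrow>\<^sub>E {- int k..int k}" for i
  define C :: "'m \<times> bool \<times> ('m \<Rightarrow> int) \<Rightarrow> (real ^ 'm) set" where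
    "C = (\<lambda>(i, b, g). {x. norm x = 1 \<and> (\<forall>j. \<bar>x $ j\<bar> \<le> \<bar>x $ i\<bar>) \<and> (0 \<le> x $ i) = b \<and>
       (\<forall>j. j \<noteq> i \<longrightarrow> \<lfloor>k * x $ j\<rfloor> = g j)})"
  define I where "I = (SIGMA i:UNIV. (UNIV :: bool set) \<times> G i)"
  have finG: "finite (G i)" for i unfolding G_def by (intro finite_PiE) auto
  have cardG: "card (G i) = (2 * k + 1) ^ (CARD('m) - 1)" for i
  proof -
    have "card {- int k..int k} = 2 * k + 1" by simp
    then show ?thesis unfolding G_def by (subst card_PiE) (auto simp: card_Diff_singleton)
  qed
  have finI: "finite I" unfolding I_def using finG by (intro finite_SigmaI finite_cartesian_product) auto
  have cardI: "card I = 2 * CARD('m) * (2 * k + 1) ^ (CARD('m) - 1)"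
    unfolding I_def by (subst card_SigmaI) (auto simp: finG card_cartesian_product cardG)
  have cover: "sphere 0 1 \<subseteq> (\<Union>i\<in>I. C i)"
  proof
    fix x :: "real ^ 'm" assume "x \<in> sphere 0 1"
    then have x: "norm x = 1" by simp
    have "Max (range (\<lambda>j. \<bar>x $ j\<bar>)) \<in> range (\<lambda>j. \<bar>x $ j\<bar>)" by (intro Max_in) auto
    then obtain i where "Max (range (\<lambda>j. \<bar>x $ j\<bar>)) = \<bar>x $ i\<bar>" by blast
    then have i: "\<bar>x $ j\<bar> \<le> \<bar>x $ i\<bar>" for j by (metis Max_ge finite finite_imageI rangeI)
    define g where "g = restrict (\<lambda>j. \<lfloor>k * x $ j\<rfloor>) (UNIV - {i})"
    have "\<lfloor>k * x $ j\<rfloor> \<in> {- int k..int k}" for j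
    proof -
      have "\<bar>x $ j\<bar> \<le> 1" using component_le_norm_cart[of x j] x by simp
      then have "- real k \<le> k * x $ j" "k * x $ j \<le> real k"
        using mult_left_mono[of "x $ j" 1 "real k"] mult_left_mono[of "-1" "x $ j" "real k"] by auto
      then show ?thesis by (auto simp: le_floor_iff) linarith
    qed
    then have "g \<in> G i" unfolding G_def g_def by auto
    then have "(i, 0 \<le> x $ i, g) \<in> I" "x \<in> C (i, 0 \<le> x $ i, g)"
      using x i unfolding I_def C_def g_def by auto
    then show "x \<in> (\<Union>i\<in>I. C i)" by blast
  qed
  have diam: "dist x y \<le> 2 * CARD('m) / k" if "p \<in> I" "x \<in> C p" "y \<in> C p" for p x y
  proof -
    obtain i b g where p: "p = (i, b, g)" by (cases p)
    have "\<bar>x $ j - y $ j\<bar> \<le> 1 / k" if "j \<noteq> i" for j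
    proof -
      have "\<lfloor>k * x $ j\<rfloor> = \<lfloor>k * y $ j\<rfloor>"
        using \<open>x \<in> C p\<close> \<open>y \<in> C p\<close> that unfolding p C_def by auto
      then have "\<bar>k * x $ j - k * y $ j\<bar> \<le> 1" by linarith
      then have "k * \<bar>x $ j - y $ j\<bar> \<le> 1"
        by (metis abs_mult abs_of_nat right_diff_distrib)
      then show ?thesis using assms(2) by (simp add: field_simps)
    qed
    then have "dist x y \<le> 2 * CARD('m) * (1 / k)"
      using that unfolding p C_def
      by (intro sphere_dominant_coordinate_Lipschitz[where i = i]) auto
    then show ?thesis by simp
  qed
  show ?thesis
    using hausdorff_content_finite_cover[OF finI cover assms(1) _ assms(3) diam]
    by (simp add: cardI mult.assoc)
qed

text \<open>With \<open>n = CARD('m) - 1\<close> and exponent \<open>n + e\<close>, there are of the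
  order of \<open>k ^ n\<close> pieces of weight \<open>k powr (- n - e)\<close> each, up to
  constants. The total decays like \<open>k powr (- e)\<close>, so the content vanishes at every
  scale.\<close>

lemma hausdorff_dim_sphere_le:
  "hausdorff_dim (sphere 0 1 :: (real ^ 'm) set) \<le> of_nat (CARD('m) - 1)"
proof (rule ennreal_le_epsilon)
  fix e :: real assume e: "e > 0"
  define n where "n = CARD('m) - 1"
  define c where "c = real CARD('m)"
  have c: "c > 0" unfolding c_def by simp
  define s where "s = n + e"
  have s: "s > 0" using e unfolding s_def by simp
  define f where "f k = 2 * c * (2 * real k + 1) ^ n * (2 * c / k) powr s" for k :: nat
  have "(\<lambda>k. 2 * c * (2 * c) powr s * (((2 * real k + 1) / k) ^ n * k powr (- e))) \<longlonglongrightarrow>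
      2 * c * (2 * c) powr s * (2 ^ n * 0)"
  proof (intro tendsto_intros)
    show "(\<lambda>k. (2 * real k + 1) / k) \<longlonglongrightarrow> 2" by real_asymp
    show "(\<lambda>k. real k powr (- e)) \<longlonglongrightarrow> 0" using e by real_asymp
  qed
  moreover have "\<forall>\<^sub>F k in sequentially.
      2 * c * (2 * c) powr s * (((2 * real k + 1) / k) ^ n * k powr (- e)) = f k"
    using eventually_gt_at_top[of 0]
  proof eventually_elim
    case (elim k)
    have "(2 * c / k) powr s = (2 * c) powr s * (real k powr (- e) / real k ^ n)"
      using elim c unfolding s_def
      by (simp add: powr_divide powr_add powr_minus powr_realpow field_simps)
    then show ?case using elim unfolding f_def by (simp add: power_divide field_simps)
  qed
  ultimately have f: "f \<longlonglongrightarrow> 0" by (simp add: filterlim_cong)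
  have "hausdorff_content s \<delta> (sphere 0 1 :: (real ^ 'm) set) = 0" if "\<delta> > 0" for \<delta>
  proof -
    have "(\<lambda>k. 2 * c / real k) \<longlonglongrightarrow> 0" by real_asymp
    then have "\<forall>\<^sub>F k in sequentially. 2 * c / real k < \<delta>" using that by (rule order_tendstoD)
    with eventually_gt_at_top[of 0]
    have "\<forall>\<^sub>F k in sequentially.
        hausdorff_content s \<delta> (sphere 0 1 :: (real ^ 'm) set) \<le> ennreal (f k)"
    proof eventually_elim
      case (elim k)
      then show ?case using sphere_content_le[where 'm = 'm, of s k \<delta>] s
        unfolding c_def n_def f_def by (simp add: add.commute)
    qed
    moreover have "(\<lambda>k. ennreal (f k)) \<longlonglongrightarrow> ennreal 0" using f by (intro tendsto_ennrealI)
    ultimately show ?thesis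
      using tendsto_lowerbound[of "\<lambda>k. ennreal (f k)" 0 sequentially] by (auto simp: eventually_sequentially)
  qed
  then have "hausdorff_measure s (sphere 0 1 :: (real ^ 'm) set) = 0"
    unfolding hausdorff_measure_def by simp
  then have "hausdorff_dim (sphere 0 1 :: (real ^ 'm) set) \<le> ennreal s"
    using s unfolding hausdorff_dim_def by (intro Inf_lower) auto
  then show "hausdorff_dim (sphere 0 1 :: (real ^ 'm) set) \<le> of_nat (CARD('m) - 1) + ennreal e"
    using e unfolding s_def n_def by (simp add: ennreal_plus ennreal_of_nat_eq_real_of_nat)
qed

section \<open>Separated points on the sphere near a given point\<close>

lemma norm_sum_orthonormal:
  fixes B :: "'a::euclidean_space set"
  assumes "pairwise orthogonal B" "\<And>b. b \<in> B \<Longrightarrow> norm b = 1" "finite B"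
  shows "(norm (\<Sum>b\<in>B. f b *\<^sub>R b))\<^sup>2 = (\<Sum>b\<in>B. (f b)\<^sup>2)"
proof -
  have "(norm (\<Sum>b\<in>B. f b *\<^sub>R b))\<^sup>2 = (\<Sum>b\<in>B. (norm (f b *\<^sub>R b))\<^sup>2)"
    using assms(1,3) by (intro norm_sum_Pythagorean) (auto simp: pairwise_def orthogonal_clauses)
  then show ?thesis using assms(2) by (simp add: power_mult_distrib)
qed

text \<open>Lift a cubical grid from the hyperplane orthogonal to \<open>x\<close> to the sphere; the lift does not
  decrease distances.\<close>

lemma sphere_separated_set:
  fixes x :: "'a::euclidean_space"
    and h :: real and K :: nat
  assumes x: "norm x = 1" and h: "h > 0" and r: "2 * h * K * DIM('a) \<le> r" "r \<le> 1"
  obtains F where "finite F" "F \<subseteq> sphere 0 1 \<inter> cball x r" "card F = K ^ (DIM('a) - 1)"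
    "\<And>y z. y \<in> F \<Longrightarrow> z \<in> F \<Longrightarrow> y \<noteq> z \<Longrightarrow> h \<le> dist y z"
proof -
  have x0: "x \<noteq> 0" using x by auto
  obtain B where B: "B \<subseteq> {y. x \<bullet> y = 0}" "pairwise orthogonal B" "\<And>b. b \<in> B \<Longrightarrow> norm b = 1"
      "independent B" "card B = dim {y. x \<bullet> y = 0}"
    using orthonormal_basis_subspace[OF subspace_hyperplane[of x]] by metis
  have finB: "finite B" using B(4) independent_imp_finite by blast
  have cardB: "card B = DIM('a) - 1" using B(5) dim_hyperplane[OF x0] by simp
  define v where "v a = (\<Sum>b\<in>B. (h * real (a b)) *\<^sub>R b)" for a :: "'a \<Rightarrow> nat"
  define u where "u a = sqrt (1 - (norm (v a))\<^sup>2) *\<^sub>R x + v a" for a :: "'a \<Rightarrow> nat"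
  define P where "P = B \<rightarrow>\<^sub>E {..<K}"
  have xv: "x \<bullet> v a = 0" for a
    using B(1) unfolding v_def by (simp add: inner_sum_right subset_eq sum.neutral)
  have finP: "finite P" unfolding P_def using finB by (intro finite_PiE) auto
  have nv: "norm (v a) \<le> r / 2" if "a \<in> P" for a
  proof -
    have "norm (v a) \<le> (\<Sum>b\<in>B. norm ((h * real (a b)) *\<^sub>R b))" unfolding v_def by (rule norm_sum)
    also have "\<dots> \<le> (\<Sum>b\<in>B. h * K)"
    proof (intro sum_mono)
      fix b assume b: "b \<in> B"
      then have "a b < K" using that unfolding P_def by auto
      then show "norm ((h * real (a b)) *\<^sub>R b) \<le> h * K" using h B(3)[OF b] by simp
    qed
    also have "\<dots> = (DIM('a) - 1) * (h * K)" by (simp add: cardB)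
    also have "\<dots> \<le> DIM('a) * (h * K)" using h by (intro mult_right_mono) auto
    finally show ?thesis using r by (simp add: algebra_simps)
  qed
  have norm_comb: "(norm (t *\<^sub>R x + w))\<^sup>2 = t\<^sup>2 + (norm w)\<^sup>2" if "x \<bullet> w = 0" for t w
    using norm_add_Pythagorean[of "t *\<^sub>R x" w] that x by (simp add: orthogonal_def)
  have small: "(norm (v a))\<^sup>2 \<le> 1" if "a \<in> P" for a
    using nv[OF that] r by (intro power_le_one) auto
  have on_sphere: "norm (u a) = 1" if "a \<in> P" for a
  proof -
    have "(norm (u a))\<^sup>2 = 1" unfolding u_def norm_comb[OF xv] using small[OF that] by simp
    then show ?thesis by (metis norm_ge_zero power2_eq_1_iff not_one_le_zero neg_0_le_iff_le
      le_minus_one_simps(3))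
  qed
  have near: "dist x (u a) \<le> r" if "a \<in> P" for a
  proof -
    \<comment> \<open>The squared distance to \<open>x\<close> is
      \<open>(1 - sqrt (1 - t))\<^sup>2 + t\<close>, hence at most \<open>2 * t\<close>. As the grid
      has radius only \<open>r / 2\<close>, this stays below \<open>r\<^sup>2\<close>.\<close>
    define t where "t = (norm (v a))\<^sup>2"
    have t: "0 \<le> t" "t \<le> 1" using small[OF that] unfolding t_def by auto
    have sq: "1 - t \<le> sqrt (1 - t)" "sqrt (1 - t) \<le> 1"
      using t real_le_rsqrt[of "1 - t" "1 - t"] by (auto simp: power2_eq_square mult_left_le)
    have "(dist x (u a))\<^sup>2 = (norm ((sqrt (1 - t) - 1) *\<^sub>R x + v a))\<^sup>2"
      unfolding dist_norm u_def t_def[symmetric] norm_minus_commute[of x] by (simp add: algebra_simps)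
    also have "\<dots> = (sqrt (1 - t) - 1)\<^sup>2 + t" unfolding norm_comb[OF xv] t_def by simp
    also have "(sqrt (1 - t) - 1)\<^sup>2 = (1 - sqrt (1 - t)) * (1 - sqrt (1 - t))"
      by (simp add: power2_eq_square algebra_simps)
    also have "\<dots> \<le> t * 1" using sq t by (intro mult_mono) auto
    also have "t * 1 + t = 2 * t" by simp
    also have "t \<le> (r / 2)\<^sup>2" unfolding t_def using nv[OF that] by (intro power_mono) auto
    also have "2 * (r / 2)\<^sup>2 \<le> r\<^sup>2" by (simp add: power_divide)
    finally have "(dist x (u a))\<^sup>2 \<le> r\<^sup>2" by simp
    moreover have "0 \<le> r" using nv[OF that] norm_ge_zero[of "v a"] by linarith
    ultimately show ?thesis by (rule power2_le_imp_le)
  qed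
  have sep: "h \<le> dist (u a) (u a')" if "a \<in> P" "a' \<in> P" "a \<noteq> a'" for a a'
  proof -
    obtain b where b: "b \<in> B" "a b \<noteq> a' b"
      using PiE_ext[of a B "\<lambda>_. {..<K}" a'] \<open>a \<in> P\<close> \<open>a' \<in> P\<close> \<open>a \<noteq> a'\<close> unfolding P_def by metis
    then have "1 \<le> \<bar>real (a b) - real (a' b)\<bar>" by auto
    then have "1 \<le> \<bar>real (a b) - real (a' b)\<bar>\<^sup>2" by (rule one_le_power)
    then have "1 \<le> (real (a b) - real (a' b))\<^sup>2" by (simp only: power2_abs)
    then have "h\<^sup>2 * 1 \<le> h\<^sup>2 * (real (a b) - real (a' b))\<^sup>2" by (intro mult_left_mono) auto
    also have "\<dots> = (h * real (a b) - h * real (a' b))\<^sup>2"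
      by (simp add: power2_eq_square algebra_simps)
    also have "\<dots> \<le> (\<Sum>b\<in>B. (h * real (a b) - h * real (a' b))\<^sup>2)"
      using b finB by (intro member_le_sum) auto
    also have "\<dots> = (norm (\<Sum>b\<in>B. (h * real (a b) - h * real (a' b)) *\<^sub>R b))\<^sup>2"
      using norm_sum_orthonormal[OF B(2,3) finB] by metis
    also have "\<dots> = (norm (v a - v a'))\<^sup>2"
      unfolding v_def by (simp add: sum_subtractf[symmetric] algebra_simps)
    \<comment> \<open>The component along \<open>x\<close> is orthogonal to
      \<open>v a - v a'\<close> and can only add to the distance.\<close>
    also have "\<dots> \<le> (dist (u a) (u a'))\<^sup>2"
    proof -
      have "u a - u a' = (sqrt (1 - (norm (v a))\<^sup>2) - sqrt (1 - (norm (v a'))\<^sup>2)) *\<^sub>R x + (v a - v a')"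
        unfolding u_def by (simp add: algebra_simps)
      then show ?thesis unfolding dist_norm
        by (simp only:) (subst norm_comb, auto simp: inner_diff_right xv)
    qed
    finally have "h\<^sup>2 \<le> (dist (u a) (u a'))\<^sup>2" by simp
    then show ?thesis by (rule power2_le_imp_le) auto
  qed
  have "inj_on u P" using sep h by (intro inj_onI) (metis dist_self not_le)
  then have "card (u ` P) = card P" by (rule card_image)
  also have "\<dots> = K ^ (DIM('a) - 1)" unfolding P_def by (subst card_PiE) (auto simp: finB cardB)
  finally have "card (u ` P) = K ^ (DIM('a) - 1)" .
  then show ?thesis using finP on_sphere near sep by (intro that[of "u ` P"]) auto
qed

section \<open>Spacing of rational points on the sphere\<close>

text \<open>The inner product of the two points is an integer over \<open>q * q'\<close> and is less
  than 1, so it falls short of 1 by at least \<open>1 / (q * q')\<close>. For unit vectors the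
  squared distance is twice this gap.\<close>

lemma rational_points_on_sphere_separated:
  fixes p p' :: "int ^ 'm"
  assumes "q > 0" "q' > 0" and "norm (rational_point p q) = 1" "norm (rational_point p' q') = 1"
    and "rational_point p q \<noteq> rational_point p' q'"
  shows "2 / (real q * real q') \<le> (dist (rational_point p q) (rational_point p' q'))\<^sup>2"
proof -
  let ?r = "rational_point p q" and ?r' = "rational_point p' q'"
  define m where "m = (\<Sum>i\<in>UNIV. p $ i * p' $ i)"
  have ip: "?r \<bullet> ?r' = of_int m / (real q * real q')"
    unfolding rational_point_def m_def inner_vec_def by (simp add: sum_divide_distrib)
  have d: "(dist ?r ?r')\<^sup>2 = 2 - 2 * (?r \<bullet> ?r')"
    using assms(3,4) by (simp add: dist_norm power2_norm_eq_inner inner_diff norm_eq_1 inner_commute)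
  moreover have "(dist ?r ?r')\<^sup>2 > 0" using assms(5) by simp
  ultimately have "?r \<bullet> ?r' < 1" by linarith
  then have "of_int m < real q * real q'" using assms(1,2) unfolding ip by (simp add: field_simps)
  then have "m < int q * int q'" by (metis of_int_less_iff of_int_mult of_int_of_nat_eq)
  then have "m + 1 \<le> int q * int q'" by simp
  then have "of_int (m + 1) \<le> real q * real q'" by (metis of_int_le_iff of_int_mult of_int_of_nat_eq)
  then show ?thesis unfolding d ip using assms(1,2) by (simp add: field_simps)
qed

text \<open>The constants: rational points with \<open>q, q' < 1 / (3 r)\<close> are more than \<open>3 r\<close> apart, and
  \<open>1 \<le> 3 N r q\<close> makes the tolerance \<open>1 / (6 N\<^sup>2 q)\<close> at most \<open>r / (2 N)\<close>.\<close>

definition near_rational :: "real \<Rightarrow> real \<Rightarrow> real ^ 'm \<Rightarrow> bool" where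
  "near_rational N r y \<longleftrightarrow> (\<exists>(p :: int ^ 'm) (q :: nat). norm (rational_point p q) = 1 \<and>
     3 * r * q < 1 \<and> 1 \<le> 3 * N * r * q \<and>
     (\<exists>z \<in> cball y (r / N). dist z (rational_point p q) \<le> 1 / (6 * N\<^sup>2 * q)))"

text \<open>Both centers lie within \<open>3 / 2 * (r / N)\<close> of rational points with
  denominators below \<open>1 / (3 * r)\<close>. Distinct points of this kind would be more than
  \<open>3 * r\<close> apart, so the two coincide. Hence at most one of several well separated
  centers is near a rational point.\<close>

lemma near_rational_dist:
  fixes y y' :: "real ^ 'm"
  assumes "r > 0" "N \<ge> 1" "near_rational N r y" "near_rational N r y'" "dist y y' \<le> 2 * (r - r / N)"
  shows "dist y y' \<le> 3 * (r / N)"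
proof -
  have key: "\<exists>(p :: int ^ 'm) (q :: nat). q > 0 \<and> norm (rational_point p q) = 1 \<and> 3 * r * q < 1 \<and>
      dist y (rational_point p q) \<le> 3 / 2 * (r / N)" if near: "near_rational N r y" for y :: "real ^ 'm"
  proof -
    obtain p :: "int ^ 'm" and q :: nat and z where
      *: "norm (rational_point p q) = 1" "3 * r * q < 1" "1 \<le> 3 * N * r * q"
         "dist y z \<le> r / N" "dist z (rational_point p q) \<le> 1 / (6 * N\<^sup>2 * q)"
      using near unfolding near_rational_def by auto
    have q: "q > 0" using *(3) by (cases q) auto
    have "1 / (6 * N\<^sup>2 * q) \<le> 3 * N * r * q / (6 * N\<^sup>2 * q)"
      using *(3) q assms(2) by (intro divide_right_mono) auto
    also have "\<dots> = 1 / 2 * (r / N)" using q assms(2) by (simp add: power2_eq_square field_simps)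
    finally have "dist y (rational_point p q) \<le> 3 / 2 * (r / N)"
      using dist_triangle[of y "rational_point p q" z] *(4,5) by linarith
    then show ?thesis using * q by blast
  qed
  obtain p :: "int ^ 'm" and q where p: "q > 0" "norm (rational_point p q) = 1" "3 * r * q < 1"
      "dist y (rational_point p q) \<le> 3 / 2 * (r / N)"
    using key[OF assms(3)] by blast
  obtain p' :: "int ^ 'm" and q' where p': "q' > 0" "norm (rational_point p' q') = 1" "3 * r * q' < 1"
      "dist y' (rational_point p' q') \<le> 3 / 2 * (r / N)"
    using key[OF assms(4)] by blast
  let ?d = "dist (rational_point p q) (rational_point p' q')"
  have "rational_point p q = rational_point p' q'"
  proof (rule ccontr)
    assume "rational_point p q \<noteq> rational_point p' q'"
    then have "2 / (real q * real q') \<le> ?d\<^sup>2"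
      using p p' by (intro rational_points_on_sphere_separated)
    moreover have "r / N \<le> r" using assms(1,2) by (simp add: field_simps)
    \<comment> \<open>The triangle inequality gives
      \<open>2 * (r - r / N) + 3 * (r / N) = 2 * r + r / N\<close>.\<close>
    then have "?d \<le> 3 * r"
      using dist_triangle[of "rational_point p q" "rational_point p' q'" y]
        dist_triangle[of y "rational_point p' q'" y'] p(4) p'(4) assms(5)
      by (simp add: dist_commute)
    then have "?d\<^sup>2 \<le> (3 * r)\<^sup>2" by (intro power_mono) auto
    ultimately have "2 / (real q * real q') \<le> (3 * r)\<^sup>2" by linarith
    then have "2 \<le> (3 * r * q) * (3 * r * q')"
      using p(1) p'(1) by (simp add: field_simps power2_eq_square)
    moreover have "(3 * r * q) * (3 * r * q') \<le> 1 * 1"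
      using p p' assms(1) by (intro mult_mono) auto
    ultimately show False by linarith
  qed
  then show ?thesis
    using dist_triangle[of y y' "rational_point p q"] p(4) p'(4) by (simp add: dist_commute)
qed

section \<open>Subballs that carry little of the weight of a cover\<close>

text \<open>Collecting indices makes the weight of all sets meeting a ball the measure of a set of
  indices, so additivity over disjoint index sets applies.\<close>

definition hits :: "('i \<Rightarrow> 'a set) \<Rightarrow> 'a set \<Rightarrow> 'i set" where
  "hits U A = {i. U i \<inter> A \<noteq> {}}"

text \<open>The invariant \<open>\<mu> (hits U (cball x r)) < (r / N) powr s\<close> forces the sets meeting
  \<open>cball x r\<close> to have diameter below \<open>r / N\<close>, so that each of them meets at most one of the
  smaller balls; averaging \<open>\<mu>\<close> over these balls then preserves the invariant.\<close>

lemma exists_subball_light: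
  fixes x :: "'a::metric_space" and \<mu> :: "'i measure"
  assumes pos: "r > 0" "N > 0" "s > 0" and sets: "sets \<mu> = UNIV"
    and U: "\<And>i. bounded (U i)" "\<And>i. ennreal (diameter (U i) powr s) \<le> emeasure \<mu> {i}"
    and light: "emeasure \<mu> (hits U (cball x r)) < ennreal ((r / N) powr s)"
    and F: "finite F" "F \<subseteq> cball x (r - r / N)"
    and sep: "\<And>y z. y \<in> F \<Longrightarrow> z \<in> F \<Longrightarrow> y \<noteq> z \<Longrightarrow> 3 * (r / N) < dist y z"
    and card: "N powr s + 1 \<le> card F"
    and bad: "\<And>y z. y \<in> F \<Longrightarrow> z \<in> F \<Longrightarrow> bad y \<Longrightarrow> bad z \<Longrightarrow> y = z"
  shows "\<exists>y\<in>F. \<not> bad y \<and> emeasure \<mu> (hits U (cball y (r / N))) < ennreal ((r / N / N) powr s)"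
proof (rule ccontr)
  assume neg: "\<not> ?thesis"
  define G where "G = {y \<in> F. \<not> bad y}"
  let ?H = "\<lambda>y. hits U (cball y (r / N))"
  have finG: "finite G" unfolding G_def using F by auto
  have "card {y \<in> F. bad y} \<le> Suc 0" using F bad by (subst card_le_Suc0_iff_eq) auto
  moreover have "card F = card G + card {y \<in> F. bad y}"
    unfolding G_def using F(1) by (subst card_Un_disjoint[symmetric]) (auto intro!: arg_cong[where f = card])
  ultimately have cardG: "N powr s \<le> card G" using card by linarith
  have sub: "?H y \<subseteq> hits U (cball x r)" if "y \<in> G" for y
  proof -
    have "dist x y \<le> r - r / N" using that F(2) unfolding G_def by auto
    have "cball y (r / N) \<subseteq> cball x r"
    proof
      fix z assume "z \<in> cball y (r / N)"
      then show "z \<in> cball x r" using \<open>dist x y \<le> r - r / N\<close> dist_triangle[of x z y] by auto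
    qed
    then show ?thesis unfolding hits_def by blast
  qed
  have diam: "diameter (U i) < r / N" if "i \<in> hits U (cball x r)" for i
  proof (rule ccontr)
    assume "\<not> diameter (U i) < r / N"
    then have "(r / N) powr s \<le> diameter (U i) powr s" using pos by (intro powr_mono2) auto
    then have "ennreal ((r / N) powr s) \<le> emeasure \<mu> {i}" using U(2)[of i] ennreal_leI order_trans by blast
    also have "\<dots> \<le> emeasure \<mu> (hits U (cball x r))" using that sets by (intro emeasure_mono) auto
    finally show False using light by simp
  qed
  have disj: "disjoint_family_on ?H G"
    unfolding disjoint_family_on_def
  proof (intro ballI impI, rule ccontr)
    fix y z assume yz: "y \<in> G" "z \<in> G" "y \<noteq> z" and "?H y \<inter> ?H z \<noteq> {}"
    then obtain i where "i \<in> ?H y" "i \<in> ?H z" by blast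
    \<comment> \<open>A set meeting both subballs would bring the centers within two radii plus its
      diameter, which is less than \<open>3 * (r / N)\<close>.\<close>
    then obtain a b where i: "i \<in> ?H y" "a \<in> U i" "b \<in> U i" "dist y a \<le> r / N" "dist z b \<le> r / N"
      unfolding hits_def by auto
    have "dist a b \<le> diameter (U i)" using diameter_bounded_bound[OF U(1) i(2,3)] .
    moreover have "diameter (U i) < r / N" using diam sub[OF yz(1)] i(1) by blast
    moreover have "3 * (r / N) < dist y z" using sep yz unfolding G_def by auto
    ultimately show False
      using dist_triangle[of y z a] dist_triangle[of a z b] i(4,5) by (simp add: dist_commute)
  qed
  \<comment> \<open>If all good subballs were heavy, their disjoint index sets, at least
    \<open>N powr s\<close> in number, would together exhaust the allowed weight
    \<open>(r / N) powr s\<close>.\<close>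
  have "ennreal ((r / N) powr s) = ennreal (N powr s * (r / N / N) powr s)"
    using pos by (simp add: powr_mult[symmetric])
  also have "\<dots> \<le> ennreal (card G * (r / N / N) powr s)"
    using cardG by (intro ennreal_leI mult_right_mono) auto
  also have "\<dots> = (\<Sum>y\<in>G. ennreal ((r / N / N) powr s))"
    by (simp add: ennreal_mult ennreal_of_nat_eq_real_of_nat)
  also have "\<dots> \<le> (\<Sum>y\<in>G. emeasure \<mu> (?H y))"
    using neg by (intro sum_mono) (auto simp: G_def not_less)
  also have "\<dots> = emeasure \<mu> (\<Union>y\<in>G. ?H y)"
    using finG disj sets by (intro sum_emeasure) auto
  also have "\<dots> \<le> emeasure \<mu> (hits U (cball x r))" using sub sets by (intro emeasure_mono) auto
  finally show False using light by simp
qed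

text \<open>\<open>C * K\<close> becomes the ratio of consecutive radii and \<open>K powr n\<close>
  the number of subballs; the summand 1 pays for the ball lost to a rational point. As
  \<open>K powr s\<close> is at least 1, it suffices that \<open>K powr (n - s)\<close> exceeds the
  constant \<open>C powr s + 1\<close>.\<close>

lemma exists_branching_number:
  fixes s n C :: real
  assumes "0 < s" "s < n" "C > 0"
  shows "\<exists>K::nat. K > 0 \<and> (C * K) powr s + 1 \<le> real K powr n"
proof -
  define d where "d = n - s"
  have "d > 0" using assms unfolding d_def by simp
  then have "filterlim (\<lambda>K::nat. real K powr d) at_top sequentially" by real_asymp
  then have "\<forall>\<^sub>F K in sequentially. C powr s + 1 \<le> real K powr d"
    unfolding filterlim_at_top by blast
  then have "\<forall>\<^sub>F K in sequentially. 0 < K \<and> C powr s + 1 \<le> real K powr d"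
    by (intro eventually_conj eventually_gt_at_top)
  then obtain K :: nat where K: "K > 0" "C powr s + 1 \<le> real K powr d"
    unfolding eventually_sequentially by blast
  have "1 \<le> real K powr s" using K(1) assms(1) by (intro ge_one_powr_ge_zero) auto
  then have "(C * K) powr s + 1 \<le> C powr s * real K powr s + real K powr s"
    using assms(3) by (simp add: powr_mult)
  also have "\<dots> = (C powr s + 1) * real K powr s" by (simp add: algebra_simps)
  also have "\<dots> \<le> real K powr d * real K powr s" using K(2) by (intro mult_right_mono) auto
  also have "\<dots> = real K powr n" unfolding d_def by (simp add: powr_add[symmetric])
  finally show ?thesis using K(1) by blast
qed

section \<open>Nested balls and the lower bound for covers\<close>

text \<open>This yields the lower bound for the dimension. The threshold \<open>\<epsilon>\<close>
  is fixed before the cover; a lighter family \<open>U\<close> would miss the badly approximable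
  limit point of suitably chosen nested balls.\<close>

lemma BA_cball_cover_weight:
  fixes x0 :: "real ^ 'm"
  assumes x0: "norm x0 = 1" and r0: "0 < r0" "r0 \<le> 1" and s: "0 < s" "s < real (CARD('m) - 1)"
  shows "\<exists>\<epsilon>>0. \<forall>U :: nat \<Rightarrow> (real ^ 'm) set. (\<forall>i. bounded (U i)) \<and> BA (sphere 0 1) \<inter> cball x0 r0 \<subseteq> (\<Union>i. U i)
    \<longrightarrow> ennreal \<epsilon> \<le> (\<Sum>i. ennreal (diameter (U i) powr s))"
proof -
  \<comment> \<open>The factor 16 lets a grid with \<open>K\<close> points per direction and spacing
    \<open>4 * (r / N)\<close> fit: \<open>2 * (4 * (r / N)) * K * CARD('m) = r / 2\<close>, and
    \<open>N \<ge> 16\<close> gives \<open>r / 2 \<le> r - r / N\<close>.\<close>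
  define C where "C = 16 * real CARD('m)"
  have C: "C \<ge> 16" unfolding C_def by (simp add: Suc_leI)
  obtain K :: nat where K: "K > 0" "(C * K) powr s + 1 \<le> real K powr real (CARD('m) - 1)"
    using exists_branching_number[OF s, of C] C by auto
  define N where "N = C * K"
  have N: "N \<ge> 16" using C K(1) mult_mono[of 16 C 1 "real K"] unfolding N_def by auto
  \<comment> \<open>Half of the threshold at level 0; the other half is left for the additional
    positive weights in \<open>w\<close>.\<close>
  define \<epsilon> where "\<epsilon> = (r0 / N) powr s / 2"
  have \<epsilon>: "\<epsilon> > 0" unfolding \<epsilon>_def using r0 N by simp
  have "ennreal \<epsilon> \<le> (\<Sum>i. ennreal (diameter (U i) powr s))"
    if U: "\<And>i. bounded (U i)" and cov: "BA (sphere 0 1) \<inter> cball x0 r0 \<subseteq> (\<Union>i. U i)"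
    for U :: "nat \<Rightarrow> (real ^ 'm) set"
  proof (rule ccontr)
    assume "\<not> ennreal \<epsilon> \<le> (\<Sum>i. ennreal (diameter (U i) powr s))"
    then have lt: "(\<Sum>i. ennreal (diameter (U i) powr s)) < ennreal \<epsilon>" by simp
    \<comment> \<open>The geometric term gives positive mass also to sets of diameter 0.\<close>
    define w where "w i = ennreal (diameter (U i) powr s) + ennreal (\<epsilon> * (1 / 2) ^ Suc i)" for i
    define \<mu> where "\<mu> = density (count_space UNIV) w"
    have sets: "sets \<mu> = UNIV" unfolding \<mu>_def by simp
    have point: "emeasure \<mu> {i} = w i" for i
      unfolding \<mu>_def by (subst emeasure_density) (auto simp: nn_integral_count_space_indicator[symmetric])
    have wpos: "w i > 0" for i using \<epsilon> unfolding w_def by (simp add: add_nonneg_pos)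
    have "(\<lambda>i. \<epsilon> * (1 / 2) ^ Suc i) sums (\<epsilon> * 1)"
      using power_half_series by (rule sums_mult)
    then have "(\<Sum>i. ennreal (\<epsilon> * (1 / 2) ^ Suc i)) = ennreal \<epsilon>"
      using \<epsilon> by (subst suminf_ennreal_eq) auto
    then have "(\<Sum>i. w i) = ennreal \<epsilon> + (\<Sum>i. ennreal (diameter (U i) powr s))"
      unfolding w_def by (subst suminf_add[symmetric]) (auto simp: add.commute)
    also have "\<dots> < ennreal \<epsilon> + ennreal \<epsilon>"
      using lt by (simp add: ennreal_add_left_cancel_less infinity_ennreal_def)
    also have "\<dots> = ennreal (\<epsilon> + \<epsilon>)" using \<epsilon> by (intro ennreal_plus[symmetric]) auto
    also have "\<epsilon> + \<epsilon> = (r0 / N) powr s" unfolding \<epsilon>_def by simp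
    finally have total: "(\<Sum>i. w i) < ennreal ((r0 / N) powr s)" .
    \<comment> \<open>The bound on the total mass gives the invariant at level 0.\<close>
    have "emeasure \<mu> A \<le> (\<Sum>i. w i)" for A
    proof -
      have "emeasure \<mu> A \<le> emeasure \<mu> UNIV" using sets by (intro emeasure_mono) auto
      also have "\<dots> = (\<Sum>i. w i)"
        unfolding \<mu>_def by (subst emeasure_density) (auto simp: nn_integral_count_space_nat)
      finally show ?thesis .
    qed
    then have total: "emeasure \<mu> A < ennreal ((r0 / N) powr s)" for A
      using total by (rule le_less_trans)

    define r where "r k = r0 / N ^ k" for k
    have r: "0 < r k" "r k \<le> 1" for k
    proof -
      show "0 < r k" unfolding r_def using r0 N by simp
      have "1 \<le> N ^ k" using N by (intro one_le_power) auto
      then show "r k \<le> 1" unfolding r_def using r0 by (simp add: field_simps)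
    qed
    have rSuc: "r (Suc k) = r k / N" for k unfolding r_def by simp
    have r_lim: "r \<longlonglongrightarrow> 0"
    proof -
      have "(\<lambda>k. r0 * (1 / N) ^ k) \<longlonglongrightarrow> r0 * 0"
        using N by (intro tendsto_intros LIMSEQ_realpow_zero) auto
      then show ?thesis unfolding r_def by (simp add: power_divide)
    qed
    \<comment> \<open>The clause for \<open>k = 0\<close> pins the first center to
      \<open>x0\<close>, since the choice principle leaves the starting point open and the limit
      must lie in \<open>cball x0 r0\<close>.\<close>
    define P where "P k y \<longleftrightarrow> norm y = 1 \<and> (k = 0 \<longrightarrow> y = x0) \<and>
      emeasure \<mu> (hits U (cball y (r k))) < ennreal ((r k / N) powr s)" for k y
    define Q where "Q k y z \<longleftrightarrow> cball z (r (Suc k)) \<subseteq> cball y (r k) \<and> \<not> near_rational N (r k) z"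
      for k and y z :: "real ^ 'm"
    have "\<exists>f. \<forall>k. P k (f k) \<and> Q k (f k) (f (Suc k))"
    proof (rule dependent_nat_choice)
      show "\<exists>y. P 0 y" using total x0 unfolding P_def r_def by auto
    next
      fix y k assume "P k y"
      then have y: "norm y = 1" "emeasure \<mu> (hits U (cball y (r k))) < ennreal ((r k / N) powr s)"
        unfolding P_def by auto
      have rN: "0 < r k / N" "r k / N \<le> r k / 2" using r[of k] N by (auto simp: field_simps)
      have "2 * (4 * (r k / N)) * K * DIM(real ^ 'm) = r k / 2"
        using N K(1) unfolding N_def C_def by (simp add: field_simps)
      also have "\<dots> \<le> r k - r k / N" using rN by linarith
      finally have grid: "2 * (4 * (r k / N)) * K * DIM(real ^ 'm) \<le> r k - r k / N" .
      obtain F where F: "finite F" "F \<subseteq> sphere 0 1 \<inter> cball y (r k - r k / N)"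
          "card F = K ^ (DIM(real ^ 'm) - 1)"
          "\<And>u z. u \<in> F \<Longrightarrow> z \<in> F \<Longrightarrow> u \<noteq> z \<Longrightarrow> 4 * (r k / N) \<le> dist u z"
        by (rule sphere_separated_set[OF y(1) _ grid]) (use rN r[of k] in auto)
      have "\<exists>z\<in>F. \<not> near_rational N (r k) z \<and>
          emeasure \<mu> (hits U (cball z (r k / N))) < ennreal ((r k / N / N) powr s)"
      proof (rule exists_subball_light)
        show "3 * (r k / N) < dist u z" if "u \<in> F" "z \<in> F" "u \<noteq> z" for u z
          using F(4)[OF that] rN by linarith
        have "real K powr real (CARD('m) - 1) = real (card F)"
          using K(1) F(3) powr_realpow[of "real K" "CARD('m) - 1"] by simp
        then show "N powr s + 1 \<le> card F" using K(2) unfolding N_def by simp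
        show "u = z" if "u \<in> F" "z \<in> F" "near_rational N (r k) u" "near_rational N (r k) z" for u z
        proof (rule ccontr)
          assume "u \<noteq> z"
          have "dist y u \<le> r k - r k / N" "dist y z \<le> r k - r k / N" using F(2) that by auto
          then have "dist u z \<le> 2 * (r k - r k / N)"
            using dist_triangle[of u z y] by (simp add: dist_commute)
          then have "dist u z \<le> 3 * (r k / N)"
            using near_rational_dist that r[of k] N by (metis dual_order.trans one_le_numeral)
          then show False using F(4)[OF that(1,2) \<open>u \<noteq> z\<close>] rN by linarith
        qed
        show "ennreal (diameter (U i) powr s) \<le> emeasure \<mu> {i}" for i
          unfolding point w_def by simp
      qed (use F r[of k] N s U sets y in auto)
      then obtain z where z: "z \<in> F" "\<not> near_rational N (r k) z"
          "emeasure \<mu> (hits U (cball z (r k / N))) < ennreal ((r k / N / N) powr s)"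
        by blast
      have "dist y z \<le> r k - r k / N" using F(2) z(1) by auto
      then have "cball z (r k / N) \<subseteq> cball y (r k)"
        by (simp add: cball_subset_cball_iff dist_commute)
      moreover have "norm z = 1" using z(1) F(2) by auto
      ultimately show "\<exists>z. P (Suc k) z \<and> Q k y z"
        using z(2,3) unfolding P_def Q_def rSuc by blast
    qed
    then obtain f where f: "\<And>k. P k (f k)" "\<And>k. Q k (f k) (f (Suc k))" by blast
    have "\<Inter> (range (\<lambda>k. sphere 0 1 \<inter> cball (f k) (r k))) \<noteq> {}"
    proof (rule compact_nest)
      show "compact (sphere 0 1 \<inter> cball (f k) (r k))" for k
        by (intro compact_Int) auto
      show "sphere 0 1 \<inter> cball (f k) (r k) \<noteq> {}" for k
        using f(1)[of k] r[of k] unfolding P_def by (auto intro!: exI[of _ "f k"])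
      show "sphere 0 1 \<inter> cball (f l) (r l) \<subseteq> sphere 0 1 \<inter> cball (f k) (r k)" if "k \<le> l" for k l
        using that by (rule lift_Suc_antimono_le[rotated]) (use f(2) in \<open>auto simp: Q_def\<close>)
    qed
    then obtain \<alpha> where "\<alpha> \<in> \<Inter> (range (\<lambda>k. sphere 0 1 \<inter> cball (f k) (r k)))" by blast
    then have \<alpha>: "norm \<alpha> = 1" "\<And>k. \<alpha> \<in> cball (f k) (r k)" by auto

    \<comment> \<open>Otherwise \<open>i\<close> would be hit at every level, so \<open>w i\<close>
      would lie below thresholds tending to \<open>(0 / N) powr s\<close>, which is 0. This is where
      positivity of \<open>w i\<close> enters.\<close>
    have "\<alpha> \<notin> U i" for i
    proof
      assume "\<alpha> \<in> U i"
      then have "i \<in> hits U (cball (f k) (r k))" for k using \<alpha>(2)[of k] unfolding hits_def by blast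
      then have "w i \<le> emeasure \<mu> (hits U (cball (f k) (r k)))" for k
        unfolding point[symmetric] using sets by (intro emeasure_mono) auto
      then have "w i \<le> ennreal ((r k / N) powr s)" for k
        using f(1)[of k] unfolding P_def by (meson le_less_trans less_imp_le)
      moreover have "(\<lambda>k. ennreal ((r k / N) powr s)) \<longlonglongrightarrow> ennreal ((0 / N) powr s)"
        using r_lim r(1) N s by (intro tendsto_ennrealI tendsto_powr' tendsto_divide tendsto_const)
          (auto intro!: always_eventually divide_nonneg_nonneg simp: less_imp_le)
      ultimately have "w i \<le> ennreal ((0 / N) powr s)" by (intro LIMSEQ_le_const) auto
      then show False using wpos[of i] by simp
    qed
    moreover have "\<alpha> \<in> cball x0 r0" using \<alpha>(2)[of 0] f(1)[of 0] unfolding P_def r_def by simp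
    moreover have "\<alpha> \<in> BA (sphere 0 1)"
    proof -
      \<comment> \<open>Small denominators are reached by unreduced fractions: \<open>p / q = (m p) / (m q)\<close>.\<close>
      define m where "m = nat \<lceil>1 / (3 * N * r0)\<rceil>"
      have m: "1 / (3 * N * r0) \<le> m" unfolding m_def by linarith
      then have m0: "m > 0" using N r0 by (cases m) (auto simp: divide_le_0_iff mult_le_0_iff)
      \<comment> \<open>\<open>c / q\<close> is the tolerance
        \<open>1 / (6 * N\<^sup>2 * q')\<close> for \<open>q' = m * q\<close>, divided by the
        constant that compares the Euclidean norm with \<open>infnorm\<close>.\<close>
      define c where "c = 1 / (6 * N\<^sup>2 * m * sqrt CARD('m))"
      have c: "c > 0" unfolding c_def using N m0 by simp
      have "infnorm (\<alpha> - rational_point p q) > c / q"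
        if "q > 0" "norm (rational_point p q) = 1" for p :: "int ^ 'm" and q
      proof -
        define p' q' where "p' = (\<chi> i. int m * p $ i)" and "q' = m * q"
        have eq: "rational_point p q = rational_point p' q'"
          unfolding rational_point_def p'_def q'_def using m0 by (simp add: vec_eq_iff)
        have q': "q' > 0" "1 / (3 * N * r0) \<le> q'"
        proof -
          show "q' > 0" unfolding q'_def using m0 that by simp
          have "m \<le> q'" unfolding q'_def using that by simp
          then show "1 / (3 * N * r0) \<le> q'" using m by linarith
        qed
        have "(\<lambda>k. 3 * r k * q') \<longlonglongrightarrow> 3 * 0 * real q'" using r_lim by (intro tendsto_intros)
        then have "\<forall>\<^sub>F k in sequentially. 3 * r k * q' < 1" by (rule order_tendstoD) simp
        then have ex: "\<exists>k. 3 * r k * q' < 1" by (auto simp: eventually_sequentially)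
        \<comment> \<open>The first scale with \<open>q' < 1 / (3 * r k)\<close>. Its failure at the
          preceding level, where the radius is \<open>N * r k\<close>, gives
          \<open>1 \<le> 3 * N * r k * q'\<close>; at level 0 the lower bound on \<open>q'\<close>
          does.\<close>
        define k where "k = (LEAST k. 3 * r k * q' < 1)"
        have k: "3 * r k * q' < 1" unfolding k_def using ex by (rule LeastI_ex)
        have "1 \<le> 3 * N * r k * q'"
        proof (cases k)
          case 0
          then show ?thesis using q' N r0 unfolding r_def by (simp add: field_simps)
        next
          case (Suc j)
          then have "\<not> 3 * r j * q' < 1" unfolding k_def using not_less_Least[of j] by (metis lessI)
          then show ?thesis using N unfolding Suc rSuc by (simp add: field_simps)
        qed
        moreover have "\<not> near_rational N (r k) (f (Suc k))" using f(2)[of k] unfolding Q_def by simp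
        moreover have "\<alpha> \<in> cball (f (Suc k)) (r k / N)" using \<alpha>(2)[of "Suc k"] unfolding rSuc .
        ultimately have "\<not> dist \<alpha> (rational_point p' q') \<le> 1 / (6 * N\<^sup>2 * q')"
          using k that(2) unfolding near_rational_def eq by blast
        then have "1 / (6 * N\<^sup>2 * q') < norm (\<alpha> - rational_point p q)" unfolding eq dist_norm by simp
        also have "\<dots> \<le> sqrt CARD('m) * infnorm (\<alpha> - rational_point p q)"
          using norm_le_infnorm[of "\<alpha> - rational_point p q"] by simp
        finally have "1 / (6 * N\<^sup>2 * q') / sqrt CARD('m) < infnorm (\<alpha> - rational_point p q)"
          by (subst pos_divide_less_eq) (simp_all add: mult.commute)
        moreover have "c / q = 1 / (6 * N\<^sup>2 * q') / sqrt CARD('m)"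
          unfolding c_def q'_def by (simp add: mult_ac)
        ultimately show ?thesis by simp
      qed
      then show ?thesis unfolding BA_def using \<alpha>(1) c by auto
    qed
    ultimately show False using cov by blast
  qed
  then show ?thesis using \<epsilon> by blast
qed

section \<open>Thickness from the two dimension bounds\<close>

theorem theorem1p2:
  fixes n :: nat
  assumes "n \<ge> 1" and "CARD('m::finite) = n + 1"
  shows "thick_in (sphere 0 1) (BA (sphere 0 1 :: (real ^ 'm) set))"
  unfolding thick_in_def
proof (intro conjI allI impI)
  let ?S = "sphere 0 1 :: (real ^ 'm) set"
  show "BA ?S \<subseteq> ?S" unfolding BA_def by blast
  fix V assume V: "openin (top_of_set ?S) V \<and> V \<noteq> {}"
  then obtain x0 where "x0 \<in> V" by blast
  moreover from V have "V \<subseteq> ?S" "\<forall>x\<in>V. \<exists>e>0. ball x e \<inter> ?S \<subseteq> V"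
    unfolding openin_contains_ball by auto
  ultimately obtain e where x0: "x0 \<in> V" "V \<subseteq> ?S" "e > 0" "ball x0 e \<inter> ?S \<subseteq> V" by blast
  \<comment> \<open>Halving \<open>e\<close> keeps the closed ball inside the open one; the cap 1 is
    required by the grid on the sphere.\<close>
  define r0 where "r0 = min (e / 2) 1"
  have r0: "0 < r0" "r0 \<le> 1" "r0 < e" unfolding r0_def using x0(3) by auto
  have BAV: "BA ?S \<inter> cball x0 r0 \<subseteq> BA ?S \<inter> V" using x0 r0 unfolding BA_def by auto
  have "ennreal n \<le> ennreal s'" if "0 \<le> s'" and zero: "hausdorff_measure s' (BA ?S \<inter> V) = 0" for s'
  proof (rule ccontr)
    assume "\<not> ennreal n \<le> ennreal s'"
    then have "s' < n" using ennreal_leI not_le by blast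
    \<comment> \<open>The midpoint is below \<open>n\<close> and positive even for
      \<open>s' = 0\<close>, where the gauge merely counts nonempty sets.\<close>
    define s where "s = (s' + n) / 2"
    have s: "0 < s" "s' < s" "s < real (CARD('m) - 1)"
      using \<open>s' < n\<close> \<open>0 \<le> s'\<close> assms unfolding s_def by auto
    obtain \<epsilon> where \<epsilon>: "\<epsilon> > 0" "\<And>U :: nat \<Rightarrow> (real ^ 'm) set. (\<And>i. bounded (U i)) \<Longrightarrow>
        BA ?S \<inter> cball x0 r0 \<subseteq> (\<Union>i. U i) \<Longrightarrow> ennreal \<epsilon> \<le> (\<Sum>i. ennreal (diameter (U i) powr s))"
    proof -
      have "norm x0 = 1" using x0(1,2) by auto
      from BA_cball_cover_weight[OF this r0(1,2) s(1,3)] that show ?thesis by metis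
    qed
    have "hausdorff_content s' 1 (BA ?S \<inter> V) < ennreal \<epsilon>"
      using hausdorff_content_eq_0_if_measure_eq_0[OF zero, of 1] \<epsilon>(1) by simp
    then obtain U where U: "BA ?S \<inter> V \<subseteq> (\<Union>i. U i)" "\<And>i. bounded (U i)" "\<And>i. diameter (U i) \<le> 1"
        "(\<Sum>i. hausdorff_gauge s' (U i)) < ennreal \<epsilon>"
      unfolding hausdorff_content_def INF_less_iff by auto
    \<comment> \<open>Diameters are at most 1, so raising the exponent from \<open>s'\<close> to
      \<open>s\<close> lowers the weight; for \<open>s' = 0\<close> the gauge of a nonempty set is
      1, and for empty sets both sides are 0.\<close>
    have "ennreal (diameter (U i) powr s) \<le> hausdorff_gauge s' (U i)" for i
    proof -
      have "0 \<le> diameter (U i)" using U(2) by (rule diameter_ge_0)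
      then have "diameter (U i) powr s \<le> 1" "diameter (U i) powr s \<le> diameter (U i) powr s'"
        using U(3)[of i] s by (auto intro!: powr_le1 powr_mono')
      then show ?thesis using s unfolding hausdorff_gauge_def by (auto intro!: ennreal_leI simp: ennreal_le_1)
    qed
    then have "(\<Sum>i. ennreal (diameter (U i) powr s)) \<le> (\<Sum>i. hausdorff_gauge s' (U i))"
      by (intro suminf_le) auto
    moreover have "ennreal \<epsilon> \<le> (\<Sum>i. ennreal (diameter (U i) powr s))"
      using U BAV by (intro \<epsilon>(2)) auto
    ultimately show False using U(4) by simp
  qed
  then have "ennreal n \<le> hausdorff_dim (BA ?S \<inter> V)"
    unfolding hausdorff_dim_def by (intro Inf_greatest) auto
  moreover have "hausdorff_dim ?S \<le> ennreal n"
    using hausdorff_dim_sphere_le[where 'm = 'm] assms by (simp add: ennreal_of_nat_eq_real_of_nat)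
  moreover have "hausdorff_dim (BA ?S \<inter> V) \<le> hausdorff_dim ?S"
    by (rule hausdorff_dim_mono) (auto simp: BA_def)
  ultimately show "hausdorff_dim (BA ?S \<inter> V) = hausdorff_dim ?S" by order
qed

end
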